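(* The statement "a tensor complementarity problem has the GUS-property if and only if the tensor involved is a $P$ tensor" fails in both directions: (1) there exist positive integers $m,n$ and a tensor $\mathcal{A}\in T_{m,n}$ such that $\mathrm{TCP}(q,\mathcal{A})$ has a unique solution for every $q\in\mathbb{R}^n$, but $\mathcal{A}$ is not a $P$ tensor; (2) there exist positive integers $m,n$ and a $P$ tensor $\mathcal{A}\in T_{m,n}$ such that it is not the case that $\mathrm{TCP}(q,\mathcal{A})$ has a unique solution for every $q\in\mathbb{R}^n$.
   Context: Write $[n]=\{1,\dots,n\}$. $T_{m,n}$ denotes the set of all real $m$th order $n$-dimensional tensors $\mathcal{A}=(a_{i_1i_2\cdots i_m})$, $i_1,\dots,i_m\in[n]$ (no symmetry assumed). For $x\in\mathbb{R}^n$, $\mathcal{A}x^{m-1}\in\mathbb{R}^n$ is defined by $(\mathcal{A}x^{m-1})_i=\sum_{i_2,\dots,i_m=1}^n a_{ii_2\cdots i_m}x_{i_2}\cdots x_{i_m}$ for $i\in[n]$. For $q\in\mathbb{R}^n$, $\mathrm{TCP}(q,\mathcal{A})$ is the problem of finding $x\in\mathbb{R}^n$ such that $x\ge 0$, $\mathcal{A}x^{m-1}+q\ge 0$ and $x^T(\mathcal{A}x^{m-1}+q)=0$ (inequalities componentwise). $\mathrm{TCP}(q,\mathcal{A})$ is said to have the GUS-property (global uniqueness and solvability) if $\mathrm{TCP}(q,\mathcal{A})$ has a unique solution for every $q\in\mathbb{R}^n$. $\mathcal{A}\in T_{m,n}$ is a $P$ tensor iff for each $x\in\mathbb{R}^n\setminus\{0\}$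 there exists $i\in[n]$ such that $x_i(\mathcal{A}x^{m-1})_i>0$. *)

theory Defs
  imports Complex_Main "HOL-Library.FuncSet" "Jordan_Normal_Form.Matrix"
begin

(* Vectors in R^n are elements of carrier_vec n, so indices run over {0..<n} instead of {1..n}.
   An m-th order n-dimensional tensor is a real function on the multi-indices of length m;
   it is taken to be extensional, so that equality of tensors is equality of all entries. *)

definition multi_indices :: "nat \<Rightarrow> nat \<Rightarrow> nat list set" where
  "multi_indices k n = {js. length js = k \<and> set js \<subseteq> {0..<n}}"

type_synonym tensor = "nat list \<Rightarrow> real"

definition tensors :: "nat \<Rightarrow> nat \<Rightarrow> tensor set" where
  "tensors m n = multi_indices m n \<rightarrow>\<^sub>E UNIV"

(* The vector A x^(m-1). *)
definition tensor_apply :: "nat \<Rightarrow> nat \<Rightarrow> tensor \<Rightarrow> real vec \<Rightarrow> real vec" where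
  "tensor_apply m n A x =
     vec n (\<lambda>i. \<Sum>js\<in>multi_indices (m - 1) n. A (i # js) * (\<Prod>j\<leftarrow>js. x $ j))"

(* The order on vectors is componentwise. *)
definition TCP_solution :: "nat \<Rightarrow> nat \<Rightarrow> real vec \<Rightarrow> tensor \<Rightarrow> real vec \<Rightarrow> bool" where
  "TCP_solution m n q A x \<longleftrightarrow>
     x \<in> carrier_vec n \<and> 0\<^sub>v n \<le> x \<and> 0\<^sub>v n \<le> tensor_apply m n A x + q \<and>
     x \<bullet> (tensor_apply m n A x + q) = 0"

definition GUS_property :: "nat \<Rightarrow> nat \<Rightarrow> tensor \<Rightarrow> bool" where
  "GUS_property m n A \<longleftrightarrow> (\<forall>q\<in>carrier_vec n. \<exists>!x. TCP_solution m n q A x)"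

definition P_tensor :: "nat \<Rightarrow> nat \<Rightarrow> tensor \<Rightarrow> bool" where
  "P_tensor m n A \<longleftrightarrow>
     A \<in> tensors m n \<and>
     (\<forall>x\<in>carrier_vec n. x \<noteq> 0\<^sub>v n \<longrightarrow> (\<exists>i<n. x $ i * tensor_apply m n A x $ i > 0))"

end

theory Submission
  imports Defs
begin

text \<open>
  Both counterexamples use that \<open>A x\<^sup>m\<^sup>-\<^sup>1\<close> is homogeneous of degree \<open>m - 1\<close>, and so for \<open>m > 2\<close>
  in general not linear: the two properties then look at different data.

  The GUS-property tests only nonnegative \<open>x\<close>, whereas being a P tensor constrains every sign
  pattern. With \<open>m = 3\<close>, \<open>n = 1\<close> and the single entry \<open>1\<close>, the map is \<open>t \<mapsto> t\<^sup>2\<close>. It is an increasing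
  bijection of the half-line, so the problem always has a unique solution, namely
  \<open>sqrt (max 0 (- q))\<close>; but \<open>t \<cdot> t\<^sup>2 < 0\<close> at \<open>t = -1\<close>. (No tensor of odd order is a P tensor:
  \<open>x\<^sub>i (A x\<^sup>m\<^sup>-\<^sup>1)\<^sub>i\<close> changes sign with \<open>x\<close>.)

  For the other direction, the P property compares \<open>A x\<^sup>m\<^sup>-\<^sup>1\<close> with its value at the origin only,
  which for a nonlinear map says nothing about two nonzero points. If the \<open>i\<close>-th component is \<open>x\<^sub>i\<close>
  times a positive definite quadratic form, the tensor is a P tensor, yet such a map need not be
  injective on the positive orthant. The map used here, with \<open>m = 4\<close> and \<open>n = 2\<close>, is
  \<open>F (s, t) = (s (s\<^sup>2 - 6 s t + 11 t\<^sup>2), t\<^sup>3)\<close>.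
  The quadratic form is \<open>(s - 3 t)\<^sup>2 + 2 t\<^sup>2\<close>, which is positive definite. On the line \<open>t = 1\<close> the first
  component minus \<open>6\<close> is \<open>(s - 1) (s - 2) (s - 3)\<close>, so for \<open>q = (-6, -1)\<close> the points \<open>(1, 1)\<close> and
  \<open>(2, 1)\<close> both satisfy \<open>F + q = 0\<close> and hence both solve the complementarity problem.
\<close>

lemma multi_indices_0: "multi_indices 0 n = {[]}"
  by (auto simp: multi_indices_def)

lemma multi_indices_Suc:
  "multi_indices (Suc k) n = (\<lambda>(i, js). i # js) ` ({0..<n} \<times> multi_indices k n)"
  by (fastforce simp: multi_indices_def length_Suc_conv image_iff)

lemma sum_multi_indices_Suc:
  fixes f :: "nat list \<Rightarrow> real"
  shows "(\<Sum>js\<in>multi_indices (Suc k) n. f js)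
       = (\<Sum>i = 0..<n. \<Sum>js\<in>multi_indices k n. f (i # js))"
proof -
  have "inj_on (\<lambda>(i, js). i # js) ({0..<n} \<times> multi_indices k n)"
    by (auto simp: inj_on_def)
  then show ?thesis
    unfolding multi_indices_Suc sum.cartesian_product
    by (subst sum.reindex) (auto intro: sum.cong)
qed

definition square_tensor :: tensor where
  "square_tensor = restrict (\<lambda>_. 1) (multi_indices 3 1)"

lemma square_tensor_apply:
  "tensor_apply 3 1 square_tensor x = vec 1 (\<lambda>_. (x $ 0)\<^sup>2)"
proof -
  have "square_tensor [0, 0, 0] = 1"
    by (simp add: square_tensor_def multi_indices_def)
  moreover have "3 - 1 = Suc (Suc 0)"
    by simp
  ultimately show ?thesis
    unfolding tensor_apply_def
    by (simp only: sum_multi_indices_Suc multi_indices_0) (auto simp: vec_eq_iff power2_eq_square)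
qed

lemma TCP_solution_square_tensor:
  assumes "q \<in> carrier_vec 1"
  shows "TCP_solution 3 1 q square_tensor x \<longleftrightarrow>
    x \<in> carrier_vec 1 \<and> 0 \<le> x $ 0 \<and> 0 \<le> (x $ 0)\<^sup>2 + q $ 0 \<and> x $ 0 * ((x $ 0)\<^sup>2 + q $ 0) = 0"
proof -
  have "0\<^sub>v 1 \<le> x \<longleftrightarrow> 0 \<le> x $ 0" if "x \<in> carrier_vec 1"
    using that by (simp add: less_eq_vec_def)
  moreover have "0\<^sub>v 1 \<le> vec 1 (\<lambda>_. (x $ 0)\<^sup>2) + q \<longleftrightarrow> 0 \<le> (x $ 0)\<^sup>2 + q $ 0"
    using assms by (simp add: less_eq_vec_def)
  moreover have "x \<bullet> (vec 1 (\<lambda>_. (x $ 0)\<^sup>2) + q) = x $ 0 * ((x $ 0)\<^sup>2 + q $ 0)"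
    using assms by (simp add: scalar_prod_def)
  ultimately show ?thesis
    unfolding TCP_solution_def square_tensor_apply by metis
qed

lemma GUS_property_square_tensor: "GUS_property 3 1 square_tensor"
  unfolding GUS_property_def
proof
  fix q :: "real vec"
  assume q: "q \<in> carrier_vec 1"
  define r where "r = sqrt (max 0 (- q $ 0))"
  have r0: "0 \<le> r"
    by (simp add: r_def)
  have r2: "r\<^sup>2 = max 0 (- q $ 0)"
    by (simp add: r_def)
  show "\<exists>!x. TCP_solution 3 1 q square_tensor x"
  proof (rule ex1I)
    show "TCP_solution 3 1 q square_tensor (vec 1 (\<lambda>_. r))"
      unfolding TCP_solution_square_tensor[OF q]
      using r0 r2 by (auto simp: max_def r_def)
  next
    fix x
    assume "TCP_solution 3 1 q square_tensor x"
    then have x: "x \<in> carrier_vec 1" "0 \<le> x $ 0" "0 \<le> (x $ 0)\<^sup>2 + q $ 0"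
      and "x $ 0 = 0 \<or> (x $ 0)\<^sup>2 = - q $ 0"
      unfolding TCP_solution_square_tensor[OF q] by auto
    then have "(x $ 0)\<^sup>2 = r\<^sup>2"
      unfolding r2 by (smt (verit) zero_le_power2 zero_power2)
    then have "x $ 0 = r"
      using x(2) r0 by simp
    then show "x = vec 1 (\<lambda>_. r)"
      using x(1) by (intro eq_vecI) auto
  qed
qed

lemma not_P_tensor_square_tensor: "\<not> P_tensor 3 1 square_tensor"
proof
  define x :: "real vec" where "x = vec 1 (\<lambda>_. - 1)"
  have x0: "x $ 0 = - 1"
    by (simp add: x_def)
  have "x \<in> carrier_vec 1" "x \<noteq> 0\<^sub>v 1"
    by (auto simp: x_def vec_eq_iff)
  moreover assume "P_tensor 3 1 square_tensor"
  ultimately obtain i where "i < 1" "x $ i * tensor_apply 3 1 square_tensor x $ i > 0"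
    unfolding P_tensor_def by blast
  then have "x $ 0 * tensor_apply 3 1 square_tensor x $ 0 > 0"
    by (metis less_one)
  then show False
    unfolding square_tensor_apply by (simp add: x0)
qed

text \<open>
  Only the sum of the entries over all orderings of the last three indices affects the map. As no
  symmetry is required, each coefficient of the cubic forms sits at a single sorted multi-index.
\<close>

definition cubic_tensor :: tensor where
  "cubic_tensor = restrict
     (\<lambda>js. if js = [0, 0, 0, 0] then 1 else if js = [0, 0, 0, 1] then - 6
       else if js = [0, 0, 1, 1] then 11 else if js = [1, 1, 1, 1] then 1 else 0)
     (multi_indices 4 2)"

lemma cubic_tensor_apply:
  "tensor_apply 4 2 cubic_tensor x =
     vec 2 (\<lambda>i. if i = 0 then x $ 0 * ((x $ 0 - 3 * x $ 1)\<^sup>2 + 2 * (x $ 1)\<^sup>2) else (x $ 1) ^ 3)"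
proof -
  have *: "cubic_tensor [i, j, k, l] =
     (if [i, j, k, l] = [0, 0, 0, 0] then 1 else if [i, j, k, l] = [0, 0, 0, 1] then - 6
       else if [i, j, k, l] = [0, 0, 1, 1] then 11 else if [i, j, k, l] = [1, 1, 1, 1] then 1 else 0)"
    if "i < 2" "j < 2" "k < 2" "l < 2" for i j k l
    using that by (simp add: cubic_tensor_def multi_indices_def)
  have arity: "4 - 1 = Suc (Suc (Suc 0))"
    by simp
  have atLeast0_lessThan_2: "{0..<2} = {0, 1 :: nat}"
    by auto
  show ?thesis
  proof (rule eq_vecI)
    fix i
    assume "i < dim_vec (vec 2 (\<lambda>i. if i = 0
      then x $ 0 * ((x $ 0 - 3 * x $ 1)\<^sup>2 + 2 * (x $ 1)\<^sup>2) else (x $ 1) ^ 3))"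
    then have "i < 2" by simp
    then consider "i = 0" | "i = 1" by linarith
    then show "tensor_apply 4 2 cubic_tensor x $ i = vec 2 (\<lambda>i. if i = 0
      then x $ 0 * ((x $ 0 - 3 * x $ 1)\<^sup>2 + 2 * (x $ 1)\<^sup>2) else (x $ 1) ^ 3) $ i"
      unfolding tensor_apply_def arity sum_multi_indices_Suc multi_indices_0
      by cases (simp_all add: atLeast0_lessThan_2 * power2_eq_square power3_eq_cube algebra_simps)
  qed (simp add: tensor_apply_def)
qed

lemma P_tensor_cubic_tensor: "P_tensor 4 2 cubic_tensor"
  unfolding P_tensor_def
proof (intro conjI ballI impI)
  show "cubic_tensor \<in> tensors 4 2"
    unfolding cubic_tensor_def tensors_def by simp
next
  fix x :: "real vec"
  assume x: "x \<in> carrier_vec 2" "x \<noteq> 0\<^sub>v 2"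
  show "\<exists>i<2. x $ i * tensor_apply 4 2 cubic_tensor x $ i > 0"
  proof (cases "x $ 0 = 0")
    case False
    have "0 < (x $ 0 - 3 * x $ 1)\<^sup>2 + 2 * (x $ 1)\<^sup>2"
      using False by (cases "x $ 1 = 0") (auto intro: add_nonneg_pos)
    then have "0 < (x $ 0)\<^sup>2 * ((x $ 0 - 3 * x $ 1)\<^sup>2 + 2 * (x $ 1)\<^sup>2)"
      using False by simp
    then have "x $ 0 * tensor_apply 4 2 cubic_tensor x $ 0 > 0"
      by (simp add: cubic_tensor_apply power2_eq_square mult.assoc)
    then show ?thesis by (intro exI[of _ 0]) simp
  next
    case True
    then have "x $ 1 \<noteq> 0"
      using x by (auto simp: vec_eq_iff less_2_cases_iff)
    then have "0 < (x $ 1) ^ 4"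
      by (simp add: zero_less_power_eq)
    then have "x $ 1 * tensor_apply 4 2 cubic_tensor x $ 1 > 0"
      by (simp add: cubic_tensor_apply flip: power_Suc)
    then show ?thesis by (intro exI[of _ 1]) simp
  qed
qed

lemma not_GUS_property_cubic_tensor: "\<not> GUS_property 4 2 cubic_tensor"
proof
  define q :: "real vec" where "q = vec 2 (\<lambda>i. if i = 0 then - 6 else - 1)"
  define y :: "real \<Rightarrow> real vec" where "y s = vec 2 (\<lambda>i. if i = 0 then s else 1)" for s
  have sol: "TCP_solution 4 2 q cubic_tensor (y s)" if "s = 1 \<or> s = 2" for s
  proof -
    have "tensor_apply 4 2 cubic_tensor (y s) + q = 0\<^sub>v 2"
      using that by (auto simp: cubic_tensor_apply q_def y_def vec_eq_iff less_2_cases_iff)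
    then show ?thesis
      using that by (auto simp: TCP_solution_def less_eq_vec_def y_def)
  qed
  assume "GUS_property 4 2 cubic_tensor"
  moreover have "q \<in> carrier_vec 2"
    by (simp add: q_def)
  ultimately have "y 1 = y 2"
    using sol[of 1] sol[of 2] unfolding GUS_property_def by blast
  then have "y 1 $ 0 = y 2 $ 0" by simp
  then show False
    by (simp add: y_def)
qed

theorem mainTheorem3:
  shows "(\<exists>m n :: nat. m > 0 \<and> n > 0 \<and>
           (\<exists>A\<in>tensors m n. GUS_property m n A \<and> \<not> P_tensor m n A)) \<and>
         (\<exists>m n :: nat. m > 0 \<and> n > 0 \<and>
           (\<exists>A\<in>tensors m n. P_tensor m n A \<and> \<not> GUS_property m n A))"
proof
  have "square_tensor \<in> tensors 3 1"
    unfolding square_tensor_def tensors_def by simp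
  then show "\<exists>m n :: nat. m > 0 \<and> n > 0 \<and>
      (\<exists>A\<in>tensors m n. GUS_property m n A \<and> \<not> P_tensor m n A)"
    using GUS_property_square_tensor not_P_tensor_square_tensor
    by (intro exI[of _ 3] exI[of _ 1]) auto
  have "cubic_tensor \<in> tensors 4 2"
    using P_tensor_cubic_tensor by (simp add: P_tensor_def)
  then show "\<exists>m n :: nat. m > 0 \<and> n > 0 \<and>
      (\<exists>A\<in>tensors m n. P_tensor m n A \<and> \<not> GUS_property m n A)"
    using P_tensor_cubic_tensor not_GUS_property_cubic_tensor
    by (intro exI[of _ 4] exI[of _ 2]) auto
qed

end
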